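(* Let $\Delta\in\mathbb F^{m\times m}$ be a connection matrix with column/row partition $J_0,\dots,J_b$. Let $\Delta^m$ be the last matrix produced by the Incremental Sweeping Algorithm (ISA) applied to $\Delta$, and let $\Delta(1)^m,\dots,\Delta(b)^m$ be the matrices produced by the Block Sequential Sweeping Algorithm applied to $\Delta$. Then $\Delta^m_{J_{k-1}J_k}=\Delta(k)^m_{J_{k-1}J_k}$ for $k=1,\dots,b$. Moreover, for each iteration $r$, the set of positions marked as primary pivots (resp. change-of-basis pivots) at iteration $r$ in the ISA run on $\Delta$ equals the union over $k=1,\dots,b$ of the sets of positions marked as primary pivots (resp. change-of-basis pivots) at iteration $r$ in the ISA runs on $\Delta(k)$.
   Context: Throughout, $\mathbb F$ is a field and $m\ge1$. $A_{IJ}$ is the submatrix of $A$ with rows in $I$, columns in $J$. $U^{pq}$ is the $m\times m$ matrix whose only nonzero entry is a $1$ in position $(p,q)$. Superscripts on matrices are indices, not powers. A connection matrix (over $\mathbb F$) is a matrix $\Delta\in\mathbb F^{m\times m}$ together with a partition $\{1,\dots,m\}=J_0\sqcup\cdots\sqcup J_b$ (the column/row partition; the $J_k$ need not consist of consecutive integers) such that $\Delta$ is upper triangular, $\Delta\Delta=0$, and $\Delta_{ij}=0$ unless $i<j$ and $(i,j)\in\bigcup_{k=1}^bJ_{k-1}\times J_k$. For $1\le r\le m-1$ the $r$-th diagonal is $\{(j-r,j):r<j\le m\}$. Incremental Sweeping Algorithm (ISA) applied to a connection matrix $\Delta$: set $\Delta^0=\Delta^1=\Delta$. For $r=1,\dots,m-1$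 in turn: (Markup) for every position $(j-r,j)$ on the $r$-th diagonal with $\Delta^r_{j-r,j}\ne0$ such that no position in column $j$ was marked as a primary pivot at an earlier iteration: if some position $(j-r,p)$ of row $j-r$ was marked as a primary pivot at an earlier iteration, mark $(j-r,j)$ as a change-of-basis pivot of iteration $r$; otherwise mark $(j-r,j)$ permanently as a primary pivot (marked at iteration $r$). (Update) Let $T^r=I-\sum \frac{\Delta^r_{j-r,j}}{\Delta^r_{j-r,p}}U^{pj}$, the sum running over all change-of-basis pivots $(j-r,j)$ of iteration $r$, where $(j-r,p)$ is the primary pivot position in row $j-r$; set $\Delta^{r+1}=(T^r)^{-1}\Delta^rT^r$. Block Sequential Sweeping Algorithm applied to $\Delta$: set $\mathcal J_0=\emptyset$. For $k=1,\dots,b$ in turn: let $\Delta(k)$ be the matrix that agrees with $\Delta$ at the positions in $(J_{k-1}\setminus\mathcal J_{k-1})\times J_k$ and is zero elsewhere (a connection matrix with the same partition); apply ISA to $\Delta(k)$, obtaining $\Delta(k)^0,\dots,\Delta(k)^m$; let $\mathcal J_k$ be the set of indices of columns containing primary pivot positions in this run. *)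

theory Defs
  imports Main
begin

text \<open>Matrices in F^{m x m} are represented as functions nat => nat => 'a,
  indexed by 1..m; entries outside {1..m} x {1..m} are irrelevant (and are zero
  for all matrices produced below).\<close>

type_synonym 'a sqmat = "nat \<Rightarrow> nat \<Rightarrow> 'a"

definition supported :: "nat \<Rightarrow> 'a::zero sqmat \<Rightarrow> bool" where
  "supported m A \<longleftrightarrow> (\<forall>i j. (i \<notin> {1..m} \<or> j \<notin> {1..m}) \<longrightarrow> A i j = 0)"

definition mmult :: "nat \<Rightarrow> 'a::comm_ring_1 sqmat \<Rightarrow> 'a sqmat \<Rightarrow> 'a sqmat" where
  "mmult m A B = (\<lambda>i j. if i \<in> {1..m} \<and> j \<in> {1..m}
                          then (\<Sum>k\<in>{1..m}. A i k * B k j) else 0)"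

definition idm :: "nat \<Rightarrow> 'a::comm_ring_1 sqmat" where
  "idm m = (\<lambda>i j. if i = j \<and> i \<in> {1..m} then 1 else 0)"

definition Umat :: "nat \<Rightarrow> nat \<Rightarrow> 'a::comm_ring_1 sqmat" where
  "Umat p q = (\<lambda>i j. if i = p \<and> j = q then 1 else 0)"

definition minv :: "nat \<Rightarrow> 'a::comm_ring_1 sqmat \<Rightarrow> 'a sqmat" where
  "minv m T = (THE S. supported m S \<and> mmult m S T = idm m \<and> mmult m T S = idm m)"

definition connection_matrix :: "nat \<Rightarrow> nat \<Rightarrow> (nat \<Rightarrow> nat set) \<Rightarrow> 'a::field sqmat \<Rightarrow> bool" where
  "connection_matrix m b J D \<longleftrightarrow>
     (\<forall>k\<le>b. J k \<noteq> {}) \<and>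
     (\<forall>k\<le>b. \<forall>l\<le>b. k \<noteq> l \<longrightarrow> J k \<inter> J l = {}) \<and>
     (\<Union>k\<le>b. J k) = {1..m} \<and>
     supported m D \<and>
     (\<forall>i\<in>{1..m}. \<forall>j\<in>{1..m}. j < i \<longrightarrow> D i j = 0) \<and>
     mmult m D D = (\<lambda>i j. 0) \<and>
     (\<forall>i\<in>{1..m}. \<forall>j\<in>{1..m}. D i j \<noteq> 0 \<longrightarrow>
        i < j \<and> (\<exists>k\<in>{1..b}. i \<in> J (k - 1) \<and> j \<in> J k))"

text \<open>ISA. A state before iteration r is the pair (Delta^r, P) where P is the set of
  positions marked as primary pivots at iterations earlier than r.\<close>

definition isa_cands :: "nat \<Rightarrow> nat \<Rightarrow> 'a::field sqmat \<times> (nat \<times> nat) set \<Rightarrow> (nat \<times> nat) set" where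
  "isa_cands m r st = {(j - r, j) | j. r < j \<and> j \<le> m \<and> fst st (j - r) j \<noteq> 0 \<and>
                                      \<not> (\<exists>i. (i, j) \<in> snd st)}"

definition isa_cob :: "nat \<Rightarrow> nat \<Rightarrow> 'a::field sqmat \<times> (nat \<times> nat) set \<Rightarrow> (nat \<times> nat) set" where
  "isa_cob m r st = {(i, j) \<in> isa_cands m r st. \<exists>p. (i, p) \<in> snd st}"

definition isa_prim :: "nat \<Rightarrow> nat \<Rightarrow> 'a::field sqmat \<times> (nat \<times> nat) set \<Rightarrow> (nat \<times> nat) set" where
  "isa_prim m r st = {(i, j) \<in> isa_cands m r st. \<not> (\<exists>p. (i, p) \<in> snd st)}"

definition prim_col :: "(nat \<times> nat) set \<Rightarrow> nat \<Rightarrow> nat" where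
  "prim_col P i = (THE p. (i, p) \<in> P)"

definition isa_T :: "nat \<Rightarrow> nat \<Rightarrow> 'a::field sqmat \<times> (nat \<times> nat) set \<Rightarrow> 'a sqmat" where
  "isa_T m r st = (\<lambda>a c. idm m a c -
      (\<Sum>(i, j)\<in>isa_cob m r st.
          (fst st i j / fst st i (prim_col (snd st) i)) * Umat (prim_col (snd st) i) j a c))"

definition isa_step :: "nat \<Rightarrow> nat \<Rightarrow> 'a::field sqmat \<times> (nat \<times> nat) set
                          \<Rightarrow> 'a sqmat \<times> (nat \<times> nat) set" where
  "isa_step m r st = (mmult m (minv m (isa_T m r st)) (mmult m (fst st) (isa_T m r st)),
                      snd st \<union> isa_prim m r st)"

text \<open>isa_state m D n = state before iteration n+1, i.e. (Delta^{n+1}, primaries marked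
  at iterations 1..n).\<close>
primrec isa_state :: "nat \<Rightarrow> 'a::field sqmat \<Rightarrow> nat \<Rightarrow> 'a sqmat \<times> (nat \<times> nat) set" where
  "isa_state m D 0 = (D, {})"
| "isa_state m D (Suc n) = isa_step m (Suc n) (isa_state m D n)"

definition isa_mat :: "nat \<Rightarrow> 'a::field sqmat \<Rightarrow> nat \<Rightarrow> 'a sqmat" where
  "isa_mat m D r = (if r = 0 then D else fst (isa_state m D (r - 1)))"

definition isa_primary_pivots :: "nat \<Rightarrow> 'a::field sqmat \<Rightarrow> nat \<Rightarrow> (nat \<times> nat) set" where
  "isa_primary_pivots m D r = isa_prim m r (isa_state m D (r - 1))"

definition isa_cob_pivots :: "nat \<Rightarrow> 'a::field sqmat \<Rightarrow> nat \<Rightarrow> (nat \<times> nat) set" where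
  "isa_cob_pivots m D r = isa_cob m r (isa_state m D (r - 1))"

definition isa_primary_cols :: "nat \<Rightarrow> 'a::field sqmat \<Rightarrow> nat set" where
  "isa_primary_cols m D = {j. \<exists>r\<in>{1..<m}. \<exists>i. (i, j) \<in> isa_primary_pivots m D r}"

definition restr :: "'a::zero sqmat \<Rightarrow> nat set \<Rightarrow> nat set \<Rightarrow> 'a sqmat" where
  "restr D I K = (\<lambda>i j. if i \<in> I \<and> j \<in> K then D i j else 0)"

primrec bss_J :: "nat \<Rightarrow> (nat \<Rightarrow> nat set) \<Rightarrow> 'a::field sqmat \<Rightarrow> nat \<Rightarrow> nat set" where
  "bss_J m J D 0 = {}"
| "bss_J m J D (Suc k) = isa_primary_cols m (restr D (J k - bss_J m J D k) (J (Suc k)))"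

definition bss_Delta :: "nat \<Rightarrow> (nat \<Rightarrow> nat set) \<Rightarrow> 'a::field sqmat \<Rightarrow> nat \<Rightarrow> 'a sqmat" where
  "bss_Delta m J D k = restr D (J (k - 1) - bss_J m J D (k - 1)) (J k)"

end

theory Submission
  imports Defs
begin

text \<open>Iteration \<open>r\<close> conjugates by \<open>I - N\<close> with \<open>N\<^sup>2 = 0\<close>: it subtracts multiples of primary columns
  from non-primary ones and adds multiples of rows to rows whose index is a primary column. Before
  iteration \<open>r\<close>, a primary pivot is the lowest nonzero entry of its column, and every nonzero entry
  on an earlier diagonal lies in a primary column. Hence at the end all nonzero columns are primary,
  with lowest entries in distinct rows, and \<open>\<Delta>\<Delta> = 0\<close> forces every row indexed by a primary column
  to vanish. So such rows never contain pivots, all other rows are only changed by column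
  operations inside one block, and the run on \<open>\<Delta>\<close> restricts to the runs on the \<open>\<Delta>(k)\<close>.\<close>

section \<open>Matrix algebra for index-function matrices and uniqueness of inverses\<close>

lemma mmult_assoc: "mmult m (mmult m A B) C = mmult m A (mmult m B C)"
proof (intro ext)
  fix i j
  show "mmult m (mmult m A B) C i j = mmult m A (mmult m B C) i j"
  proof (cases "i \<in> {1..m} \<and> j \<in> {1..m}")
    case True
    then have "mmult m (mmult m A B) C i j = (\<Sum>l\<in>{1..m}. \<Sum>k\<in>{1..m}. A i k * B k l * C l j)"
      by (simp add: mmult_def sum_distrib_right)
    also have "\<dots> = (\<Sum>k\<in>{1..m}. \<Sum>l\<in>{1..m}. A i k * B k l * C l j)"
      by (rule sum.swap)
    also have "\<dots> = mmult m A (mmult m B C) i j"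
      using True by (simp add: mmult_def sum_distrib_left mult.assoc)
    finally show ?thesis .
  qed (auto simp: mmult_def)
qed

lemma mmult_idm_left: "supported m A \<Longrightarrow> mmult m (idm m) A = A"
  by (intro ext) (auto simp: mmult_def idm_def supported_def if_distrib[of "\<lambda>x. x * _"] cong: if_cong)

lemma mmult_idm_right: "supported m A \<Longrightarrow> mmult m A (idm m) = A"
  by (intro ext) (auto simp: mmult_def idm_def supported_def if_distrib[of "\<lambda>x. _ * x"] cong: if_cong)

lemma supported_mmult: "supported m (mmult m A B)"
  by (auto simp: supported_def mmult_def)

lemma supported_idm: "supported m (idm m)"
  by (auto simp: supported_def idm_def)

text \<open>\<open>minv\<close> is a definite description, so exhibiting a two-sided inverse is
  enough once any other one is shown equal to it by associativity.\<close>

lemma minv_eqI: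
  assumes "supported m S" "mmult m S T = idm m" "mmult m T S = idm m"
  shows "minv m T = S"
  unfolding minv_def
proof (rule the_equality)
  fix S' assume S': "supported m S' \<and> mmult m S' T = idm m \<and> mmult m T S' = idm m"
  have "S' = mmult m S' (mmult m T S)"
    unfolding assms(3) using S' by (simp add: mmult_idm_right)
  also have "\<dots> = mmult m (mmult m S' T) S"
    by (simp only: mmult_assoc)
  also have "\<dots> = S"
    using S' assms(1) by (simp add: mmult_idm_left)
  finally show "S' = S" .
qed (use assms in auto)

section \<open>One iteration as conjugation by \<open>I - N\<close> with
  \<open>N = step_nil m r st\<close>\<close>

definition step_nil :: "nat \<Rightarrow> nat \<Rightarrow> 'a::field sqmat \<times> (nat \<times> nat) set \<Rightarrow> 'a sqmat" where
  "step_nil m r st = (\<lambda>a c. if (c - r, c) \<in> isa_cob m r st \<and> a = prim_col (snd st) (c - r)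
                            then fst st (c - r) c / fst st (c - r) a else 0)"

lemma isa_cob_D: "(i, j) \<in> isa_cob m r st \<Longrightarrow> r < j \<and> j \<le> m \<and> i = j - r"
  by (auto simp: isa_cob_def isa_cands_def)

lemma finite_isa_cob: "finite (isa_cob m r st)"
  by (rule finite_subset[of _ "(\<lambda>j. (j - r, j)) ` {..m}"]) (auto dest: isa_cob_D)

text \<open>Distinct change-of-basis pivots of one iteration lie in distinct columns, so at most one
  summand reaches column \<open>c\<close>. The difference \<open>c - r\<close> in
  \<open>step_nil\<close> is never truncated where it matters: membership in \<open>isa_cob\<close>
  forces \<open>r < c\<close>.\<close>

lemma isa_T_eq: "isa_T m r st = (\<lambda>a c. idm m a c - step_nil m r st a c)"
proof (intro ext)
  fix a c
  let ?pc = "prim_col (snd st)"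
  let ?f = "\<lambda>x. case x of (i, j) \<Rightarrow> (fst st i j / fst st i (?pc i)) * Umat (?pc i) j a c"
  have "sum ?f (isa_cob m r st) = sum ?f (isa_cob m r st \<inter> {(c - r, c)})"
    by (rule sum.mono_neutral_right)
       (auto simp: finite_isa_cob Umat_def dest: isa_cob_D split: if_splits)
  also have "\<dots> = step_nil m r st a c"
    by (auto simp: step_nil_def Umat_def Int_insert_right)
  finally show "isa_T m r st a c = idm m a c - step_nil m r st a c"
    by (simp add: isa_T_def)
qed

text \<open>At most one primary pivot per row is what makes the description in
  \<open>prim_col\<close> denote.\<close>

definition pivots_wf :: "nat \<Rightarrow> (nat \<times> nat) set \<Rightarrow> bool" where
  "pivots_wf m P \<longleftrightarrow> P \<subseteq> {1..m} \<times> {1..m} \<and> (\<forall>i j j'. (i, j) \<in> P \<longrightarrow> (i, j') \<in> P \<longrightarrow> j = j')"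

lemma prim_col_eq: "pivots_wf m P \<Longrightarrow> (i, p) \<in> P \<Longrightarrow> prim_col P i = p"
  unfolding prim_col_def pivots_wf_def by (rule the_equality) blast+

lemma step_nil_nonzeroD:
  assumes "pivots_wf m P" "step_nil m r (A, P) a c \<noteq> 0"
  shows "r < c" "c \<le> m" "(c - r, a) \<in> P" "(x, c) \<notin> P" "A (c - r) c \<noteq> 0"
  using assms prim_col_eq[OF assms(1)]
  by (auto simp: step_nil_def isa_cob_def isa_cands_def split: if_splits)

lemma mmult_diff_right:
  "mmult m A (\<lambda>a c. B a c - C a c) = (\<lambda>a c. mmult m A B a c - mmult m A C a c)"
  for A :: "'a::comm_ring_1 sqmat"
  by (intro ext) (auto simp: mmult_def right_diff_distrib sum_subtractf)

lemma mmult_add_right: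
  "mmult m A (\<lambda>a c. B a c + C a c) = (\<lambda>a c. mmult m A B a c + mmult m A C a c)"
  for A :: "'a::comm_ring_1 sqmat"
  by (intro ext) (auto simp: mmult_def distrib_left sum.distrib)

lemma mmult_diff_left:
  "mmult m (\<lambda>a c. B a c - C a c) A = (\<lambda>a c. mmult m B A a c - mmult m C A a c)"
  for A :: "'a::comm_ring_1 sqmat"
  by (intro ext) (auto simp: mmult_def left_diff_distrib sum_subtractf)

lemma mmult_add_left:
  "mmult m (\<lambda>a c. B a c + C a c) A = (\<lambda>a c. mmult m B A a c + mmult m C A a c)"
  for A :: "'a::comm_ring_1 sqmat"
  by (intro ext) (auto simp: mmult_def distrib_right sum.distrib)

text \<open>Nonzero rows of \<open>N\<close> are indexed by primary columns, nonzero columns of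
  \<open>N\<close> are not primary. Hence \<open>N\<close> squares to zero and \<open>I + N\<close>
  inverts \<open>I - N\<close>.\<close>

lemma isa_T_inverse:
  fixes A :: "'a::field sqmat" and r :: nat
  assumes "pivots_wf m P"
  defines "N \<equiv> step_nil m r (A, P)"
  defines "S \<equiv> (\<lambda>a c. idm m a c + N a c)"
  shows "minv m (isa_T m r (A, P)) = S"
    and "mmult m (isa_T m r (A, P)) S = idm m"
proof -
  note nz = step_nil_nonzeroD[OF assms(1), of r A, folded N_def]
  have T: "isa_T m r (A, P) = (\<lambda>a c. idm m a c - N a c)"
    by (simp add: isa_T_eq N_def)
  have N: "supported m N"
    unfolding supported_def
  proof (intro allI impI, rule ccontr)
    fix a c assume "a \<notin> {1..m} \<or> c \<notin> {1..m}" "N a c \<noteq> 0"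
    then show False
      using nz[of a c] assms(1) by (auto simp: pivots_wf_def)
  qed
  have NN: "mmult m N N = (\<lambda>a c. 0)"
  proof -
    have "N a l * N l c = 0" for a l c
      using nz(4)[of a l] nz(3)[of l c] by (metis mult_eq_0_iff)
    then show ?thesis by (simp add: mmult_def fun_eq_iff del: mult_eq_0_iff)
  qed
  have S: "supported m S"
    using N by (auto simp: supported_def S_def idm_def)
  show TS: "mmult m (isa_T m r (A, P)) S = idm m"
    unfolding T S_def
    by (simp add: mmult_diff_left mmult_add_right NN mmult_idm_left mmult_idm_right N supported_idm)
  have ST: "mmult m S (isa_T m r (A, P)) = idm m"
    unfolding T S_def
    by (simp add: mmult_add_left mmult_diff_right NN mmult_idm_left mmult_idm_right N supported_idm)
  show "minv m (isa_T m r (A, P)) = S"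
    by (rule minv_eqI[OF S ST TS])
qed

definition col_update :: "nat \<Rightarrow> 'a::field sqmat \<Rightarrow> 'a sqmat \<Rightarrow> 'a sqmat" where
  "col_update m A N = (\<lambda>i j. A i j - mmult m A N i j)"

text \<open>Splits the conjugation into column operations, \<open>A - A N\<close>, followed by row
  operations, multiplication by \<open>I + N\<close> from the left. Later arguments treat the two
  halves in turn.\<close>

lemma fst_isa_step:
  fixes A :: "'a::field sqmat" and r :: nat
  assumes "pivots_wf m P" "supported m A"
  defines "N \<equiv> step_nil m r (A, P)"
  shows "fst (isa_step m r (A, P)) =
    (\<lambda>i j. col_update m A N i j + mmult m N (col_update m A N) i j)"
proof -
  have "supported m (col_update m A N)"
    using assms(2) by (auto simp: supported_def col_update_def mmult_def)
  moreover have "mmult m A (isa_T m r (A, P)) = col_update m A N"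
    using assms(2) by (simp add: isa_T_eq N_def mmult_diff_right mmult_idm_right col_update_def)
  ultimately show ?thesis
    by (simp add: isa_step_def isa_T_inverse(1)[OF assms(1)] N_def mmult_add_left mmult_idm_left)
qed

lemma mmult_nonzeroE:
  assumes "mmult m A B i j \<noteq> 0"
  obtains k where "A i k \<noteq> 0" "B k j \<noteq> 0"
proof -
  have "\<exists>k. A i k * B k j \<noteq> 0"
    using assms by (auto simp: mmult_def split: if_splits elim: sum.not_neutral_contains_not_neutral)
  then show ?thesis using that mult_not_zero by blast
qed

lemma mmult_eq_0I: "(\<And>k. A i k \<noteq> 0 \<Longrightarrow> B k j = 0) \<Longrightarrow> mmult m A B i j = 0"
  by (metis mmult_nonzeroE)

section \<open>Block structure and the invariant of the sweep\<close>

locale sweep =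
  fixes m b :: nat and J :: "nat \<Rightarrow> nat set" and D :: "'a::field sqmat"
  assumes conn: "connection_matrix m b J D"
begin

lemma J_disjoint: "k \<le> b \<Longrightarrow> l \<le> b \<Longrightarrow> i \<in> J k \<Longrightarrow> i \<in> J l \<Longrightarrow> k = l"
  using conn unfolding connection_matrix_def by blast

definition adj :: "nat \<Rightarrow> nat \<Rightarrow> bool" where
  "adj i j \<longleftrightarrow> i < j \<and> (\<exists>k\<in>{1..b}. i \<in> J (k - 1) \<and> j \<in> J k)"

text \<open>The positions where \<open>N\<close> may be nonzero: column \<open>p\<close> is
  subtracted from a later column \<open>j\<close> of its own block. The index \<open>k\<close>
  starts at 1 because nonzero columns lie in \<open>J 1\<close>, ..., \<open>J b\<close>.\<close>

definition same_block :: "nat \<Rightarrow> nat \<Rightarrow> bool" where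
  "same_block p j \<longleftrightarrow> p < j \<and> (\<exists>k\<in>{1..b}. p \<in> J k \<and> j \<in> J k)"

lemma J_pred_disjoint:
  "k \<in> {1..b} \<Longrightarrow> l \<in> {1..b} \<Longrightarrow> i \<in> J (k - 1) \<Longrightarrow> i \<in> J (l - 1) \<Longrightarrow> k = l"
  using J_disjoint[of "k - 1" "l - 1" i] by (simp add: le_diff_conv) arith

lemma adj_col: "adj i j \<Longrightarrow> k \<in> {1..b} \<Longrightarrow> i \<in> J (k - 1) \<Longrightarrow> j \<in> J k"
  using J_pred_disjoint unfolding adj_def by blast

lemma adj_row: "adj i j \<Longrightarrow> k \<in> {1..b} \<Longrightarrow> j \<in> J k \<Longrightarrow> i \<in> J (k - 1)"
  using J_disjoint unfolding adj_def by (metis atLeastAtMost_iff)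

lemma adj_same_block: "adj i p \<Longrightarrow> adj i j \<Longrightarrow> p < j \<Longrightarrow> same_block p j"
  using adj_col unfolding adj_def same_block_def by blast

text \<open>Used for the column operations: a product \<open>A N\<close> keeps its nonzero entries
  at the allowed positions.\<close>

lemma adj_same_block_trans: "adj i p \<Longrightarrow> same_block p j \<Longrightarrow> adj i j"
proof -
  assume ip: "adj i p" and "same_block p j"
  then obtain k where k: "k \<in> {1..b}" "p \<in> J k" "j \<in> J k" "p < j"
    unfolding same_block_def by blast
  then have "i \<in> J (k - 1)" using adj_row[OF ip] by blast
  with ip k show "adj i j" unfolding adj_def by auto
qed

text \<open>The counterpart for the row operations, that is, for products with \<open>N\<close> on
  the left.\<close>

lemma same_block_adj_trans: "same_block p j \<Longrightarrow> adj j l \<Longrightarrow> adj p l"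
proof -
  assume "same_block p j" "adj j l"
  then obtain k k' where k: "k \<in> {1..b}" "p \<in> J k" "j \<in> J k" "p < j"
    and k': "k' \<in> {1..b}" "j \<in> J (k' - 1)" "l \<in> J k'" "j < l"
    unfolding adj_def same_block_def by blast
  then have "k = k' - 1" using J_disjoint[of k "k' - 1" j] by auto
  with k k' show "adj p l" unfolding adj_def by auto
qed

text \<open>Describes the state before iteration \<open>r\<close>. The condition
  \<open>j < i + r\<close> says without subtraction that \<open>(i, j)\<close> lies on a diagonal
  swept earlier, or on or below the main diagonal.\<close>

definition pivot_inv :: "nat \<Rightarrow> 'a sqmat \<times> (nat \<times> nat) set \<Rightarrow> bool" where
  "pivot_inv r st \<longleftrightarrow> (case st of (A, P) \<Rightarrow>
     supported m A \<and> mmult m A A = (\<lambda>i j. 0) \<and> (\<forall>i j. A i j \<noteq> 0 \<longrightarrow> adj i j) \<and>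
     pivots_wf m P \<and>
     (\<forall>i j. (i, j) \<in> P \<longrightarrow> A i j \<noteq> 0 \<and> (\<forall>i'>i. A i' j = 0) \<and> j < i + r) \<and>
     (\<forall>i j. A i j \<noteq> 0 \<longrightarrow> j < i + r \<longrightarrow> (\<exists>i'. (i', j) \<in> P)))"

lemma pivot_inv_step:
  assumes "pivot_inv r (A, P)"
  shows "pivot_inv (Suc r) (isa_step m r (A, P))"
proof -
  have sup: "supported m A" and AA: "mmult m A A = (\<lambda>i j. 0)"
    and gr: "\<And>i j. A i j \<noteq> 0 \<Longrightarrow> adj i j"
    and wf: "pivots_wf m P"
    and piv: "\<And>i j. (i, j) \<in> P \<Longrightarrow> A i j \<noteq> 0" "\<And>i j i'. (i, j) \<in> P \<Longrightarrow> i < i' \<Longrightarrow> A i' j = 0"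
      "\<And>i j. (i, j) \<in> P \<Longrightarrow> j < i + r"
    and low: "\<And>i j. A i j \<noteq> 0 \<Longrightarrow> j < i + r \<Longrightarrow> \<exists>i'. (i', j) \<in> P"
    using assms unfolding pivot_inv_def by auto
  define N where "N = step_nil m r (A, P)"
  define B where "B = col_update m A N"
  define A' where "A' = fst (isa_step m r (A, P))"
  define Q where "Q = isa_prim m r (A, P)"
  note nz = step_nil_nonzeroD[OF wf, of r A, folded N_def]
  have A': "A' = (\<lambda>i j. B i j + mmult m N B i j)"
    unfolding A'_def B_def N_def by (rule fst_isa_step[OF wf sup])
  have step: "isa_step m r (A, P) = (A', P \<union> Q)"
    by (simp add: A'_def Q_def isa_step_def)
  \<comment> \<open>Row \<open>j - r\<close> has nonzero entries in both columns, \<open>p\<close>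
    holding its primary pivot. That pivot was marked earlier, so \<open>p < j\<close>.\<close>
  have Nbl: "same_block p j" if "N p j \<noteq> 0" for p j
    using nz[OF that] gr piv by (intro adj_same_block[of "j - r"]) fastforce+
  have sup': "supported m A'"
    unfolding A'_def isa_step_def by (simp add: supported_mmult)
  \<comment> \<open>With \<open>A' = S A T\<close> and \<open>T S = I\<close>, the square telescopes
    to \<open>S (A A) T\<close>.\<close>
  have AA': "mmult m A' A' = (\<lambda>i j. 0)"
  proof -
    let ?T = "isa_T m r (A, P)" and ?S = "\<lambda>a c. idm m a c + N a c"
    have "A' = mmult m ?S (mmult m A ?T)"
      by (simp add: A'_def isa_step_def isa_T_inverse(1)[OF wf] N_def)
    then have "mmult m A' A' = mmult m ?S (mmult m A (mmult m (mmult m ?T ?S) (mmult m A ?T)))"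
      by (simp add: mmult_assoc)
    also have "\<dots> = mmult m ?S (mmult m (mmult m A A) ?T)"
      by (simp add: isa_T_inverse(2)[OF wf] N_def mmult_idm_left supported_mmult mmult_assoc)
    also have "\<dots> = (\<lambda>i j. 0)"
      unfolding AA by (simp add: mmult_def fun_eq_iff)
    finally show ?thesis .
  qed
  have grB: "adj i j" if "B i j \<noteq> 0" for i j
  proof -
    have "A i j \<noteq> 0 \<or> mmult m A N i j \<noteq> 0"
      using that by (auto simp: B_def col_update_def)
    then show ?thesis
      by (auto elim!: mmult_nonzeroE intro: gr adj_same_block_trans[OF gr Nbl])
  qed
  have gr': "adj i j" if "A' i j \<noteq> 0" for i j
  proof -
    have "B i j \<noteq> 0 \<or> mmult m N B i j \<noteq> 0"
      using that by (auto simp: A')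
    then show ?thesis
      by (auto elim!: mmult_nonzeroE intro: grB same_block_adj_trans[OF Nbl grB])
  qed
  \<comment> \<open>New pivots lie in rows without a pivot, and all on one diagonal, hence in
    different rows.\<close>
  have wf': "pivots_wf m (P \<union> Q)"
  proof -
    have "(i, j) \<in> Q \<Longrightarrow> i \<in> {1..m} \<and> j \<in> {1..m} \<and> j = i + r \<and> (\<forall>p. (i, p) \<notin> P)" for i j
      by (auto simp: Q_def isa_prim_def isa_cands_def)
    then show ?thesis
      using wf unfolding pivots_wf_def by (simp add: subset_iff) blast
  qed
  \<comment> \<open>Facts about \<open>A\<close> before the update. For a new pivot
    \<open>(i, j)\<close>, entries of column \<open>j\<close> below row \<open>i\<close> lie on
    earlier diagonals, so a nonzero one would make \<open>j\<close> already primary. Column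
    \<open>j\<close> of \<open>N\<close> vanishes, as it would require an earlier pivot in row
    \<open>i\<close>.\<close>
  have low_piv: "A i j \<noteq> 0 \<and> (\<forall>i'>i. A i' j = 0) \<and> j < i + Suc r \<and> (\<forall>p. N p j = 0)"
    if "(i, j) \<in> P \<union> Q" for i j
  proof (cases "(i, j) \<in> P")
    case True
    then show ?thesis using piv[OF True] nz(4) by fastforce
  next
    case False
    then have q: "(i, j) \<in> isa_prim m r (A, P)" using that by (simp add: Q_def)
    then have ij: "A i j \<noteq> 0" "j = i + r" "\<And>i. (i, j) \<notin> P" "\<And>p. (i, p) \<notin> P"
      by (auto simp: isa_prim_def isa_cands_def)
    have "A i' j = 0" if "i < i'" for i'
      using low[of i' j] ij that by auto
    moreover have "N p j = 0" for p
      using nz(3)[of p j] ij(2,4) by auto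
    ultimately show ?thesis using ij by simp
  qed
  \<comment> \<open>Column operations leave pivot columns alone. Row operations add only lower rows
    to a row, so from row \<open>i\<close> downwards they add zeros in column
    \<open>j\<close>.\<close>
  have piv': "A' i j \<noteq> 0 \<and> (\<forall>i'>i. A' i' j = 0) \<and> j < i + Suc r" if "(i, j) \<in> P \<union> Q" for i j
  proof -
    note lp = low_piv[OF that]
    have B: "B x j = A x j" for x
      using lp by (auto simp: B_def col_update_def intro: mmult_eq_0I)
    have "mmult m N B x j = 0" if "i \<le> x" for x
      using that lp Nbl[of x] by (intro mmult_eq_0I) (force simp: B same_block_def)
    then show ?thesis
      using lp by (auto simp: A' B)
  qed
  have low': "\<exists>i'. (i', j) \<in> P \<union> Q" if "A' i j \<noteq> 0" "j < i + Suc r" for i j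
  proof (rule ccontr)
    assume "\<nexists>i'. (i', j) \<in> P \<union> Q"
    then have nP: "\<And>x. (x, j) \<notin> P" and nQ: "\<And>x. (x, j) \<notin> Q" by auto
    have A0: "A x j = 0" if "j < x + r" for x
      using low nP that by blast
    \<comment> \<open>A nonzero \<open>N l j\<close> means that column \<open>l\<close> has its
      pivot, its lowest nonzero entry, in row \<open>j - r\<close>. Row \<open>x\<close> lies below
      that row, so the subtracted entry is zero.\<close>
    have "B x j = 0" if "j < x + r" for x
    proof -
      have "mmult m A N x j = 0"
      proof (rule mmult_eq_0I, rule ccontr)
        fix l assume "A x l \<noteq> 0" "N l j \<noteq> 0"
        then show False using nz[of l j] piv(2)[of "j - r" l x] that by fastforce
      qed
      then show ?thesis using A0[OF that] by (simp add: B_def col_update_def)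
    qed
    \<comment> \<open>On the diagonal of the iteration, a nonzero entry in a column that stays
      non-primary is a change-of-basis pivot, and the coefficient in \<open>N\<close> is chosen to
      cancel it.\<close>
    moreover have "B x j = 0" if x: "j = x + r" for x
    proof (cases "A x j = 0")
      case True
      then have "N l j = 0" for l using nz(5)[of l j] x by auto
      then have "mmult m A N x j = 0" by (intro mmult_eq_0I)
      with True show ?thesis by (simp add: B_def col_update_def)
    next
      case False
      then have xj: "x \<in> {1..m}" "j \<in> {1..m}" using sup unfolding supported_def by blast+
      then have "(x, j) \<in> isa_cands m r (A, P)"
        using False nP x by (auto simp: isa_cands_def)
      moreover have "(x, j) \<notin> isa_prim m r (A, P)" using nQ by (simp add: Q_def)
      ultimately have cob: "(x, j) \<in> isa_cob m r (A, P)"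
        by (auto simp: isa_prim_def isa_cob_def)
      then obtain p where p: "(x, p) \<in> P" by (auto simp: isa_cob_def)
      then have Nj: "N l j = (if l = p then A x j / A x p else 0)" for l
        using cob x prim_col_eq[OF wf p] by (simp add: N_def step_nil_def)
      have "p \<in> {1..m}" using p wf by (auto simp: pivots_wf_def)
      then have "mmult m A N x j = A x j"
        using xj piv(1)[OF p] by (simp add: mmult_def Nj if_distrib[of "\<lambda>x. _ * x"] cong: if_cong)
      then show ?thesis by (simp add: B_def col_update_def)
    qed
    ultimately have B0: "B x j = 0" if "j < x + Suc r" for x
      using that by (metis add_Suc_right less_Suc_eq)
    \<comment> \<open>Row \<open>i\<close> receives only rows below it; their entries in column
      \<open>j\<close> lie on even earlier diagonals and vanish by \<open>B0\<close>.\<close>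
    have "mmult m N B i j = 0"
      using that(2) Nbl[of i] by (intro mmult_eq_0I B0) (force simp: same_block_def)
    then show False using that B0[of i] by (simp add: A')
  qed
  show ?thesis
    unfolding step pivot_inv_def using sup' AA' gr' wf' piv' low' by auto
qed

text \<open>The index shifts by one because \<open>isa_state m D n\<close> is the state before
  iteration \<open>Suc n\<close>.\<close>

lemma pivot_inv_state: "pivot_inv (Suc n) (isa_state m D n)"
proof (induction n)
  case 0
  have "supported m D" "mmult m D D = (\<lambda>i j. 0)"
    using conn unfolding connection_matrix_def by auto
  moreover have gr: "adj i j" if "D i j \<noteq> 0" for i j
  proof -
    have "i \<in> {1..m}" "j \<in> {1..m}"
      using that \<open>supported m D\<close> unfolding supported_def by blast+
    then show ?thesis using conn that unfolding connection_matrix_def adj_def by blast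
  qed
  moreover have "D i j = 0" if "j < i + 1" for i j
    using gr[of i j] that by (auto simp: adj_def)
  ultimately show ?case by (auto simp: pivot_inv_def pivots_wf_def)
next
  case (Suc n)
  then show ?case
    using pivot_inv_step[of "Suc n" "fst (isa_state m D n)" "snd (isa_state m D n)"] by simp
qed

lemmas pivot_inv_state' = pivot_inv_state[unfolded pivot_inv_def case_prod_beta]

section \<open>Vanishing of the rows indexed by primary columns\<close>

definition final_cols :: "nat set" where
  "final_cols = {j. \<exists>i. (i, j) \<in> snd (isa_state m D (m - 1))}"

text \<open>The nonzero columns of the final \<open>A\<close> have their lowest entries in distinct
  rows, so they are linearly independent. Since \<open>A\<close> times its column \<open>j\<close>
  is zero, every coefficient of a nonzero column in this combination must vanish.\<close>

lemma final_row_zero: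
  assumes "i \<in> final_cols"
  shows "fst (isa_state m D (m - 1)) i j = 0"
proof (rule ccontr)
  obtain A P where st: "isa_state m D (m - 1) = (A, P)" by fastforce
  have sup: "supported m A" and AA: "mmult m A A = (\<lambda>i j. 0)"
    and wf: "pivots_wf m P"
    and piv: "\<And>i j. (i, j) \<in> P \<Longrightarrow> A i j \<noteq> 0" "\<And>i j i'. (i, j) \<in> P \<Longrightarrow> i < i' \<Longrightarrow> A i' j = 0"
    and low: "\<And>i j. A i j \<noteq> 0 \<Longrightarrow> j < i + Suc (m - 1) \<Longrightarrow> \<exists>i'. (i', j) \<in> P"
    using pivot_inv_state[of "m - 1"] unfolding pivot_inv_def st by auto
  \<comment> \<open>Inside the matrix \<open>j \<le> m < i + m\<close> always holds, so the diagonal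
    bound disappears and every nonzero column is primary.\<close>
  have low: "\<exists>i'. (i', j) \<in> P" if "A i j \<noteq> 0" for i j
  proof -
    have "i \<in> {1..m}" "j \<in> {1..m}" using that sup unfolding supported_def by blast+
    with low[OF that] show ?thesis by auto
  qed
  assume "fst (isa_state m D (m - 1)) i j \<noteq> 0"
  then have ij: "A i j \<noteq> 0" unfolding st by simp
  \<comment> \<open>Pivot rows of the columns that occur with nonzero coefficient. At the largest
    such row only one term of the product survives: any other column reaching it would have its
    pivot in the same row.\<close>
  define X where "X = {h. \<exists>l. (h, l) \<in> P \<and> A l j \<noteq> 0}"
  have "X \<subseteq> {1..m}" using wf by (auto simp: X_def pivots_wf_def)
  then have fX: "finite X" by (rule finite_subset) simp
  have "X \<noteq> {}" using assms ij unfolding X_def final_cols_def st by auto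
  then have "Max X \<in> X" using fX by simp
  then obtain l where l: "(Max X, l) \<in> P" "A l j \<noteq> 0" by (auto simp: X_def)
  have rng: "Max X \<in> {1..m}" "l \<in> {1..m}" "j \<in> {1..m}"
    using l wf sup unfolding pivots_wf_def supported_def by blast+
  have other: "A (Max X) l' * A l' j = 0" if "l' \<noteq> l" for l'
  proof (rule ccontr)
    assume "A (Max X) l' * A l' j \<noteq> 0"
    then have nz: "A (Max X) l' \<noteq> 0" "A l' j \<noteq> 0" by auto
    obtain h where h: "(h, l') \<in> P" using low[OF nz(1)] by blast
    have "\<not> h < Max X" using piv(2)[OF h] nz(1) by blast
    moreover have "h \<le> Max X" using fX h nz(2) by (auto simp: X_def intro: Max_ge)
    ultimately have "h = Max X" by simp
    then show False using h l(1) wf that unfolding pivots_wf_def by blast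
  qed
  have "(\<Sum>k\<in>{1..m}. A (Max X) k * A k j) = A (Max X) l * A l j"
    using rng sum.neutral[of "{1..m} - {l}", OF ballI[OF other]] by (subst sum.remove[of _ l]) auto
  moreover have "(\<Sum>k\<in>{1..m}. A (Max X) k * A k j) = 0"
    using fun_cong[OF fun_cong[OF AA], of "Max X" j] rng by (simp add: mmult_def)
  ultimately show False using piv(1)[OF l(1)] l(2) by simp
qed

lemma snd_isa_state_mono: "n \<le> n' \<Longrightarrow> snd (isa_state m E n) \<subseteq> snd (isa_state m E n')"
  by (induction n' rule: dec_induct) (auto simp: isa_step_def)

text \<open>The row of a candidate has a primary pivot at the latest after this iteration. That
  pivot entry is still nonzero at the end, so the final row is not zero.\<close>

lemma isa_cands_row_not_final:
  assumes "n < m - 1" "(i, j) \<in> isa_cands m (Suc n) (isa_state m D n)"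
  shows "i \<notin> final_cols"
proof
  let ?st = "isa_state m D n"
  assume "i \<in> final_cols"
  have "(\<exists>p. (i, p) \<in> snd ?st) \<or> (i, j) \<in> isa_prim m (Suc n) ?st"
    using assms(2) by (auto simp: isa_prim_def)
  then have "\<exists>p. (i, p) \<in> snd (isa_state m D (Suc n))"
    by (auto simp: isa_step_def)
  then obtain p where "(i, p) \<in> snd (isa_state m D (m - 1))"
    using snd_isa_state_mono[of "Suc n" "m - 1" D] assms(1) by auto
  then show False
    using pivot_inv_state'[of "m - 1"] final_row_zero[OF \<open>i \<in> final_cols\<close>] by blast
qed

section \<open>Restriction of the full run to one block\<close>

context
  fixes k assumes k: "k \<in> {1..b}"
begin

text \<open>The removed rows are those of the finished full run, so the same restriction applies at
  every iteration.\<close>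

abbreviation "rest A \<equiv> restr A (J (k - 1) - final_cols) (J k)"

definition restr_state :: "'a sqmat \<times> (nat \<times> nat) set \<Rightarrow> 'a sqmat \<times> (nat \<times> nat) set" where
  "restr_state st = (rest (fst st), snd st \<inter> UNIV \<times> J k)"

lemma restr_pivots:
  assumes "n < m - 1"
  defines "st \<equiv> isa_state m D n"
  shows "isa_prim m (Suc n) (restr_state st) = isa_prim m (Suc n) st \<inter> UNIV \<times> J k" (is ?prim)
    and "isa_cob m (Suc n) (restr_state st) = isa_cob m (Suc n) st \<inter> UNIV \<times> J k" (is ?cob)
proof -
  have gr: "\<And>i j. fst st i j \<noteq> 0 \<Longrightarrow> adj i j" "\<And>i j. (i, j) \<in> snd st \<Longrightarrow> fst st i j \<noteq> 0"
    using pivot_inv_state'[of n] unfolding st_def by auto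
  have row: "i \<in> J (k - 1) - final_cols" if "(i, j) \<in> isa_cands m (Suc n) st" "j \<in> J k" for i j
  proof -
    have "fst st i j \<noteq> 0" using that(1) by (auto simp: isa_cands_def)
    then show ?thesis
      using isa_cands_row_not_final[OF assms(1)] that adj_row[OF gr(1) k] by (auto simp: st_def)
  qed
  have cands: "isa_cands m (Suc n) (restr_state st) = isa_cands m (Suc n) st \<inter> UNIV \<times> J k"
  proof (intro set_eqI iffI)
    fix x assume "x \<in> isa_cands m (Suc n) (restr_state st)"
    then show "x \<in> isa_cands m (Suc n) st \<inter> UNIV \<times> J k"
      by (auto simp: isa_cands_def restr_state_def restr_def split: if_splits)
  next
    fix x assume x: "x \<in> isa_cands m (Suc n) st \<inter> UNIV \<times> J k"
    then obtain i j where [simp]: "x = (i, j)" by fastforce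
    have "i \<in> J (k - 1) - final_cols" "j \<in> J k" using x row[of i j] by auto
    then show "x \<in> isa_cands m (Suc n) (restr_state st)"
      using x by (auto simp: isa_cands_def restr_state_def restr_def)
  qed
  \<comment> \<open>The row block determines the column block, so the primary pivot needed by a
    candidate survives the restriction to \<open>J k\<close>.\<close>
  have "p \<in> J k" if "(i, j) \<in> isa_cands m (Suc n) st" "j \<in> J k" "(i, p) \<in> snd st" for i j p
    using row[OF that(1,2)] adj_col[OF gr(1)[OF gr(2)[OF that(3)]] k] by auto
  then have *: "(\<exists>p. (i, p) \<in> snd (restr_state st)) \<longleftrightarrow> (\<exists>p. (i, p) \<in> snd st)"
    if "(i, j) \<in> isa_cands m (Suc n) st" "j \<in> J k" for i j
    using that by (auto simp: restr_state_def)
  show ?prim ?cob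
    unfolding isa_prim_def isa_cob_def cands using * by auto
qed

text \<open>Column operations stay inside a block and hence commute with the restriction. Row
  operations alter only rows in \<open>final_cols\<close>, which the restriction deletes; in the
  block run they do nothing.\<close>

lemma restr_step:
  assumes "n < m - 1"
  defines "st \<equiv> isa_state m D n"
  shows "isa_step m (Suc n) (restr_state st) = restr_state (isa_step m (Suc n) st)"
proof -
  obtain A P where st: "st = (A, P)" by fastforce
  define A1 where "A1 = rest A"
  define P1 where "P1 = P \<inter> UNIV \<times> J k"
  have st1: "restr_state (A, P) = (A1, P1)" by (simp add: restr_state_def A1_def P1_def)
  have sup: "supported m A" and gr: "\<And>i j. A i j \<noteq> 0 \<Longrightarrow> adj i j"
    and wf: "pivots_wf m P" and piv: "\<And>i j. (i, j) \<in> P \<Longrightarrow> A i j \<noteq> 0"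
    using pivot_inv_state[of n] unfolding st_def[symmetric] st pivot_inv_def by auto
  have sup1: "supported m A1" using sup by (auto simp: supported_def A1_def restr_def)
  have wf1: "pivots_wf m P1" using wf by (auto simp: pivots_wf_def P1_def)
  define N where "N = step_nil m (Suc n) (A, P)"
  define N1 where "N1 = step_nil m (Suc n) (A1, P1)"
  define B where "B = col_update m A N"
  define B1 where "B1 = col_update m A1 N1"
  note nz = step_nil_nonzeroD[OF wf, of "Suc n" A, folded N_def]
  have Nblock: "l \<in> J k" if "N l j \<noteq> 0" "j \<in> J k" for l j
    using adj_col[OF gr[OF piv[OF nz(3)[OF that(1)]]] k adj_row[OF gr[OF nz(5)[OF that(1)]] k that(2)]] .
  have Nfinal: "l \<in> final_cols" if "N l j \<noteq> 0" for l j
    using nz(3)[OF that] snd_isa_state_mono[of n "m - 1" D] assms(1) st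
    by (auto simp: final_cols_def st_def)
  have N1: "N1 a c = (if c \<in> J k then N a c else 0)" for a c
  proof -
    let ?i = "c - Suc n"
    note cob = restr_pivots(2)[OF assms(1), folded st_def, unfolded st, unfolded st1]
    show ?thesis
    proof (cases "(?i, c) \<in> isa_cob m (Suc n) (A1, P1)")
      case True
      then have T: "(?i, c) \<in> isa_cob m (Suc n) (A, P)" "c \<in> J k" using cob by auto
      obtain p where p: "(?i, p) \<in> P1" using True by (auto simp: isa_cob_def)
      have "p \<in> J k" "(?i, p) \<in> P" using p by (auto simp: P1_def)
      moreover have "A1 ?i c \<noteq> 0" using True by (auto simp: isa_cob_def isa_cands_def)
      ultimately show ?thesis
        using True T prim_col_eq[OF wf1 p] prim_col_eq[OF wf, of ?i p]
        by (auto simp: N1_def N_def step_nil_def A1_def restr_def split: if_splits)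
    next
      case False
      then have "c \<in> J k \<Longrightarrow> (?i, c) \<notin> isa_cob m (Suc n) (A, P)" using cob by auto
      with False show ?thesis by (auto simp: N1_def N_def step_nil_def)
    qed
  qed
  have B1: "B1 = rest B"
  proof (intro ext)
    fix i j
    have "A1 i l * N1 l j = (if i \<in> J (k - 1) - final_cols \<and> j \<in> J k then A i l * N l j else 0)"
      for l using Nblock[of l j] by (auto simp: A1_def restr_def N1)
    then have "mmult m A1 N1 i j =
        (if i \<in> J (k - 1) - final_cols \<and> j \<in> J k then mmult m A N i j else 0)"
      by (cases "i \<in> J (k - 1) - final_cols \<and> j \<in> J k")
        (simp_all only: mmult_def if_True if_False simp_thms sum.neutral_const if_cancel)
    then show "B1 i j = rest B i j"
      by (simp add: B1_def B_def col_update_def A1_def restr_def)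
  qed
  \<comment> \<open>A nonzero term would need an index in both \<open>J k\<close> and
    \<open>J (k - 1)\<close>.\<close>
  have "mmult m N1 B1 i j = 0" for i j
  proof (rule mmult_eq_0I, rule ccontr)
    fix l assume "N1 i l \<noteq> 0" "B1 l j \<noteq> 0"
    then have "l \<in> J k" "l \<in> J (k - 1)" by (auto simp: N1 B1 restr_def split: if_splits)
    then show False using J_disjoint[of k "k - 1" l] k by (simp add: le_diff_conv) arith
  qed
  moreover have "rest (\<lambda>i j. B i j + mmult m N B i j) = rest B"
  proof -
    have "mmult m N B i j = 0" if "i \<notin> final_cols" for i j
      using that Nfinal by (intro mmult_eq_0I) blast
    then show ?thesis by (auto simp: restr_def fun_eq_iff)
  qed
  ultimately have "fst (isa_step m (Suc n) (A1, P1)) = rest (fst (isa_step m (Suc n) (A, P)))"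
    by (simp add: fst_isa_step[OF wf sup] fst_isa_step[OF wf1 sup1] B1
        flip: N_def N1_def B_def B1_def)
  moreover have "snd (isa_step m (Suc n) (A1, P1)) = snd (isa_step m (Suc n) (A, P)) \<inter> UNIV \<times> J k"
    using restr_pivots(1)[OF assms(1), folded st_def, unfolded st, unfolded st1]
    by (auto simp: isa_step_def P1_def)
  ultimately show ?thesis
    unfolding st st1 by (simp add: restr_state_def prod_eq_iff)
qed

lemma isa_state_rest: "n \<le> m - 1 \<Longrightarrow> isa_state m (rest D) n = restr_state (isa_state m D n)"
  by (induction n) (simp add: restr_state_def, simp add: restr_step)

end

section \<open>Comparison with the Block Sequential Sweeping Algorithm\<close>

lemma snd_isa_state_eq: "snd (isa_state m E n) = (\<Union>r\<in>{1..n}. isa_primary_pivots m E r)"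
  by (induction n) (auto simp: isa_step_def isa_primary_pivots_def atLeastAtMostSuc_conv)

lemma isa_primary_cols_eq: "isa_primary_cols m E = {j. \<exists>i. (i, j) \<in> snd (isa_state m E (m - 1))}"
proof -
  have "{1..<m} = {1..m - 1}" by auto
  then show ?thesis unfolding isa_primary_cols_def snd_isa_state_eq by auto
qed

lemma pivot_block:
  assumes "fst (isa_state m D n) i j \<noteq> 0"
  shows "\<exists>k\<in>{1..b}. j \<in> J k"
  using pivot_inv_state'[of n] assms unfolding adj_def by blast

lemma pivot_nonzero:
  "(i, j) \<in> snd (isa_state m D n) \<Longrightarrow> fst (isa_state m D n) i j \<noteq> 0"
  using pivot_inv_state'[of n] by blast

text \<open>Inductively, the rows removed for the next block are exactly those in
  \<open>final_cols\<close>, so its run is the restriction of the full run and finds the same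
  primary columns there. In the base case no pivot column lies in \<open>J 0\<close>.\<close>

lemma bss_J_eq: "k \<le> b \<Longrightarrow> bss_J m J D k = final_cols \<inter> J k"
proof (induction k)
  case 0
  have False if piv: "(i, j) \<in> snd (isa_state m D (m - 1))" and "j \<in> J 0" for i j
  proof -
    obtain k where "k \<in> {1..b}" "j \<in> J k"
      using pivot_block[OF pivot_nonzero[OF piv]] by blast
    then show False using J_disjoint[of k 0 j] \<open>j \<in> J 0\<close> by auto
  qed
  then show ?case by (auto simp: final_cols_def)
next
  case (Suc k)
  have "J k - final_cols \<inter> J k = J k - final_cols" by blast
  then have "bss_J m J D (Suc k) = isa_primary_cols m (restr D (J k - final_cols) (J (Suc k)))"
    using Suc by simp
  then show ?case
    using isa_state_rest[of "Suc k" "m - 1"] Suc.prems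
    by (auto simp: isa_primary_cols_eq restr_state_def final_cols_def)
qed

lemma isa_state_bss_Delta:
  assumes "k \<in> {1..b}" "n \<le> m - 1"
  shows "isa_state m (bss_Delta m J D k) n = restr_state k (isa_state m D n)"
proof -
  have "J (k - 1) - final_cols \<inter> J (k - 1) = J (k - 1) - final_cols" by blast
  moreover have "k - 1 \<le> b" using assms(1) by auto
  ultimately show ?thesis
    using isa_state_rest[OF assms] by (simp add: bss_Delta_def bss_J_eq)
qed

text \<open>Only rows in \<open>final_cols\<close> differ by construction: the block run has zeros
  there from the start, the full run at the end by \<open>final_row_zero\<close>.\<close>

lemma final_entries:
  assumes "k \<in> {1..b}" "i \<in> J (k - 1)" "j \<in> J k" "m \<ge> 1"
  shows "isa_mat m D m i j = isa_mat m (bss_Delta m J D k) m i j"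
  using assms final_row_zero[of i j]
  by (auto simp: isa_mat_def isa_state_bss_Delta restr_state_def restr_def)

text \<open>Every candidate has its column in some \<open>J k\<close> with \<open>k \<ge> 1\<close>,
  so cutting by column blocks loses nothing.\<close>

lemma pivots_union:
  assumes "r \<in> {1..<m}"
  shows "isa_primary_pivots m D r = (\<Union>k\<in>{1..b}. isa_primary_pivots m (bss_Delta m J D k) r)"
    and "isa_cob_pivots m D r = (\<Union>k\<in>{1..b}. isa_cob_pivots m (bss_Delta m J D k) r)"
proof -
  obtain n where n: "r = Suc n" "n < m - 1" using assms by (cases r) auto
  have blk: "\<exists>k\<in>{1..b}. j \<in> J k" if "(i, j) \<in> isa_cands m r (isa_state m D n)" for i j
    using that pivot_block[of n i j] by (auto simp: isa_cands_def)
  have "isa_prim m r (isa_state m D n) = (\<Union>k\<in>{1..b}. isa_prim m r (isa_state m D n) \<inter> UNIV \<times> J k)"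
    using blk by (fastforce simp: isa_prim_def)
  then show "isa_primary_pivots m D r = (\<Union>k\<in>{1..b}. isa_primary_pivots m (bss_Delta m J D k) r)"
    using n by (simp add: isa_primary_pivots_def isa_state_bss_Delta restr_pivots)
  have "isa_cob m r (isa_state m D n) = (\<Union>k\<in>{1..b}. isa_cob m r (isa_state m D n) \<inter> UNIV \<times> J k)"
    using blk by (fastforce simp: isa_cob_def)
  then show "isa_cob_pivots m D r = (\<Union>k\<in>{1..b}. isa_cob_pivots m (bss_Delta m J D k) r)"
    using n by (simp add: isa_cob_pivots_def isa_state_bss_Delta restr_pivots)
qed

end

theorem mainTheorem6:
  fixes D :: "'a::field sqmat" and m b :: nat and J :: "nat \<Rightarrow> nat set"
  assumes "m \<ge> 1"
    and "connection_matrix m b J D"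
  shows "(\<forall>k\<in>{1..b}. \<forall>i\<in>J (k - 1). \<forall>j\<in>J k.
            isa_mat m D m i j = isa_mat m (bss_Delta m J D k) m i j)
       \<and> (\<forall>r\<in>{1..<m}. isa_primary_pivots m D r
                        = (\<Union>k\<in>{1..b}. isa_primary_pivots m (bss_Delta m J D k) r))
       \<and> (\<forall>r\<in>{1..<m}. isa_cob_pivots m D r
                        = (\<Union>k\<in>{1..b}. isa_cob_pivots m (bss_Delta m J D k) r))"
proof -
  interpret sweep m b J D by unfold_locales (rule assms(2))
  show ?thesis
    using assms(1) by (intro conjI ballI final_entries pivots_union)
qed

end
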